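(* Let $\mathcal{L}$ be the set of free states of a quantum resource theory on a finite-dimensional Hilbert space, let $\rho\notin\mathcal{L}$ be a resource state with generalized robustness $\mathcal{R}_{\mathcal{L}}(\rho)$, and let $Y^*$ be an optimal robustness witness for $\rho$. Let $\beta\in(0,\infty)$ be the inverse temperature of a thermal bath. Then for every real $\lambda>0$ with $\lambda\ge\beta^{-1}S(\rho)/\mathcal{R}_{\mathcal{L}}(\rho)$, $$\xi_{\mathrm{cost}}(\rho)\;\le\;\frac{1+\lambda^{-1}\beta^{-1}S\big(\tau^\beta_{\lambda Y^*}\big)}{1+\mathcal{R}_{\mathcal{L}}(\rho)+\lambda^{-1}\beta^{-1}\Big(S\big(\tau^\beta_{\lambda Y^*}\big)-S(\rho)\Big)},$$ where $\tau^{\beta}_{\lambda Y^*}$ is the thermal state of the Hamiltonian $\lambda Y^*$ at inverse temperature $\beta$. Moreover, at zero temperature, $\xi_{\mathrm{cost}}(\rho)\le \dfrac{1}{1+\mathcal{R}_{\mathcal{L}}(\rho)}$.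
   Context: All Hilbert spaces are finite-dimensional; a state is a positive semidefinite operator of unit trace. $\mathcal{L}$ is a nonempty, closed, convex set of states, called free (resource-less) states; states not in $\mathcal{L}$ are called resource states. Generalized robustness: $\mathcal{R}_{\mathcal{L}}(\rho):=\min\{s\ge 0 : \text{there is a state }\gamma\text{ with }\frac{\rho+s\gamma}{1+s}\in\mathcal{L}\}$. One has $\mathcal{R}_{\mathcal{L}}(\rho)=0$ if and only if $\rho\in\mathcal{L}$. It has the dual form $\mathcal{R}_{\mathcal{L}}(\rho)=\max\{\mathrm{Tr}(Y\rho)-1 : Y\ge 0,\ \mathrm{Tr}(Y\sigma)\le 1\ \forall\sigma\in\mathcal{L}\}$ ($Y$ Hermitian). An optimal robustness witness for $\rho$ is an operator $Y^*\ge0$ with $\mathrm{Tr}(Y^*\sigma)\le 1$ for all $\sigma\in\mathcal{L}$ and $\mathrm{Tr}(Y^*\rho)-1=\mathcal{R}_{\mathcal{L}}(\rho)$. For a Hamiltonian (Hermitian operator) $H$: $S(\rho)=-\mathrm{Tr}(\rho\log\rho)$ is the von Neumann entropy (natural logarithm), $F_H(\rho):=\mathrm{Tr}(H\rho)-\beta^{-1}S(\rho)$ is the free energy, $\tau_H^\beta:=e^{-\beta H}/\mathrm{Tr}(e^{-\beta H})$ is the thermal state, and the work cost of preparing $\rho$ from the thermal state is $W_H^{\mathrm{cost}}(\rho):=F_H(\rho)-F_H(\tau_H^\beta)\ge0$. The relative cost is $$\xi_{\mathrm{cost}}(\rho):=\min_{H\ge 0}\frac{\max_{\sigma\in\mathcal{L}}W_H^{\mathrm{cost}}(\sigma)}{W_H^{\mathrm{cost}}(\rho)},$$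 the minimum (an infimum if not attained) being over all positive semidefinite Hamiltonians $H$ on the system; Hamiltonians for which the denominator $W_H^{\mathrm{cost}}(\rho)$ vanishes are excluded. Zero temperature means $\beta^{-1}=0$: the entropic terms vanish, so $F_H(\rho)=\mathrm{Tr}(H\rho)$ and $F_H(\tau_H^\beta)$ is replaced by the smallest eigenvalue of $H$, and $\xi_{\mathrm{cost}}$ is defined with these quantities. *)

theory Defs
  imports "HOL-Analysis.Analysis"
begin

definition hermitian :: "complex^'n^'n \<Rightarrow> bool" where
  "hermitian A \<longleftrightarrow> (\<forall>i j. A $ i $ j = cnj (A $ j $ i))"

text \<open>The library's inner product on \<open>complex^'n\<close> is the real part of the usual sesquilinear
  one, which for Hermitian \<open>A\<close> makes \<open>v \<bullet> (A *v v)\<close> the usual (real) quadratic form.\<close>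

definition psd :: "complex^'n^'n \<Rightarrow> bool" where
  "psd A \<longleftrightarrow> hermitian A \<and> (\<forall>v. 0 \<le> v \<bullet> (A *v v))"

definition is_state :: "complex^'n^'n \<Rightarrow> bool" where
  "is_state \<rho> \<longleftrightarrow> psd \<rho> \<and> trace \<rho> = 1"

definition free_states :: "(complex^'n^'n) set \<Rightarrow> bool" where
  "free_states L \<longleftrightarrow> L \<noteq> {} \<and> closed L \<and> convex L \<and> (\<forall>\<sigma>\<in>L. is_state \<sigma>)"

text \<open>Traces of products of two Hermitian matrices are real, so taking the real part
  loses nothing.\<close>

definition expval :: "complex^'n^'n \<Rightarrow> complex^'n^'n \<Rightarrow> real" where
  "expval A \<rho> = Re (trace (A ** \<rho>))"

subsection \<open>Functions of Hermitian matrices\<close>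

definition eigenspace :: "complex^'n^'n \<Rightarrow> real \<Rightarrow> (complex^'n) set" where
  "eigenspace A x = {v. A *v v = x *\<^sub>R v}"

definition eigenvalues :: "complex^'n^'n \<Rightarrow> real set" where
  "eigenvalues A = {x. \<exists>v\<in>eigenspace A x. v \<noteq> 0}"

text \<open>The nearest-point map onto a subspace is the orthogonal projection onto it. It is
  complex linear here, as eigenspaces are complex subspaces.\<close>

definition eigenprojection :: "complex^'n^'n \<Rightarrow> real \<Rightarrow> complex^'n^'n" where
  "eigenprojection A x = matrix (closest_point (eigenspace A x))"

text \<open>Spectral calculus: \<open>f(A) = \<Sum>\<^sub>x f(x) P\<^sub>x\<close> for Hermitian \<open>A\<close> with spectral
  projections \<open>P\<^sub>x\<close>.\<close>

definition spectral_fun :: "(real \<Rightarrow> real) \<Rightarrow> complex^'n^'n \<Rightarrow> complex^'n^'n" where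
  "spectral_fun f A = (\<Sum>x\<in>eigenvalues A. f x *\<^sub>R eigenprojection A x)"

subsection \<open>Thermodynamic quantities\<close>

text \<open>The value given to \<open>ln 0\<close> is irrelevant: \<open>\<rho>\<close> annihilates its own kernel, so
  the convention \<open>0 log 0 = 0\<close> holds automatically.\<close>

definition entropy :: "complex^'n^'n \<Rightarrow> real" where
  "entropy \<rho> = - Re (trace (\<rho> ** spectral_fun ln \<rho>))"

definition free_energy :: "real \<Rightarrow> complex^'n^'n \<Rightarrow> complex^'n^'n \<Rightarrow> real" where
  "free_energy \<beta> H \<rho> = expval H \<rho> - inverse \<beta> * entropy \<rho>"

definition thermal_state :: "real \<Rightarrow> complex^'n^'n \<Rightarrow> complex^'n^'n" where
  "thermal_state \<beta> H =
    (let E = spectral_fun exp ((- \<beta>) *\<^sub>R H) in inverse (Re (trace E)) *\<^sub>R E)"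

definition work_cost :: "real \<Rightarrow> complex^'n^'n \<Rightarrow> complex^'n^'n \<Rightarrow> real" where
  "work_cost \<beta> H \<rho> = free_energy \<beta> H \<rho> - free_energy \<beta> H (thermal_state \<beta> H)"

definition work_cost_zero_temp :: "complex^'n^'n \<Rightarrow> complex^'n^'n \<Rightarrow> real" where
  "work_cost_zero_temp H \<rho> = expval H \<rho> - Min (eigenvalues H)"

text \<open>\<open>W\<close> is one of the two work costs above. Both are nonnegative on states and, for fixed
  \<open>H\<close>, continuous in the state. As \<open>L\<close> is nonempty and compact, the supremum is therefore an
  attained maximum and the infimum is over a set bounded below by 0; that set is nonempty
  whenever \<open>\<rho>\<close> is a state outside \<open>L\<close>.\<close>

definition relative_cost ::
  "(complex^'n^'n \<Rightarrow> complex^'n^'n \<Rightarrow> real) \<Rightarrow> (complex^'n^'n) set \<Rightarrow> complex^'n^'n \<Rightarrow> real"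
where
  "relative_cost W L \<rho> = (INF H\<in>{H. psd H \<and> W H \<rho> \<noteq> 0}. (SUP \<sigma>\<in>L. W H \<sigma>) / W H \<rho>)"

subsection \<open>Robustness\<close>

text \<open>Extended real, because no admissible \<open>s\<close> need exist (for instance if \<open>L\<close> is a
  singleton containing a pure state); the value is then \<open>\<infinity>\<close>.\<close>

definition robustness :: "(complex^'n^'n) set \<Rightarrow> complex^'n^'n \<Rightarrow> ereal" where
  "robustness L \<rho> =
    (INF s\<in>{s::real. 0 \<le> s \<and>
      (\<exists>\<gamma>. is_state \<gamma> \<and> inverse (1 + s) *\<^sub>R (\<rho> + s *\<^sub>R \<gamma>) \<in> L)}. ereal s)"

text \<open>An optimal witness exists only if the robustness is finite.\<close>

definition optimal_witness ::
  "(complex^'n^'n) set \<Rightarrow> complex^'n^'n \<Rightarrow> complex^'n^'n \<Rightarrow> bool"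
where
  "optimal_witness L \<rho> Y \<longleftrightarrow>
    psd Y \<and> (\<forall>\<sigma>\<in>L. expval Y \<sigma> \<le> 1) \<and> ereal (expval Y \<rho> - 1) = robustness L \<rho>"

end

theory Submission
  imports Defs
begin

text \<open>Take \<open>H = l Y\<close> and write \<open>\<tau>\<close> for its thermal state. The witness inequalities and
  \<open>S \<ge> 0\<close> bound the work cost of every free state by \<open>a - c\<close>, while that of \<open>\<rho>\<close> equals \<open>b - c\<close>, where
  \<open>a = l + S(\<tau>)/\<beta>\<close>, \<open>b = l (1 + R) + (S(\<tau>) - S(\<rho>))/\<beta>\<close> and \<open>c = Tr(H \<tau>) \<ge> 0\<close>. The condition
  on \<open>l\<close> says \<open>a \<le> b\<close>, so \<open>(a - c)/(b - c) \<le> a/b\<close>. That \<open>b - c\<close> is positive follows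
  from Gibbs' variational principle with its equality case.

  The spectral calculus is handled through bases of \<open>complex^'n\<close> that are orthonormal over the
  reals: a self-adjoint map has such an eigenbasis, and the real part of the complex trace is half
  the real trace.\<close>

subsection \<open>Real orthonormal bases\<close>

definition orthonormal_basis :: "'a::euclidean_space set \<Rightarrow> bool" where
  "orthonormal_basis B \<longleftrightarrow>
    finite B \<and> (\<forall>b\<in>B. \<forall>c\<in>B. b \<bullet> c = (if b = c then 1 else 0)) \<and> span B = UNIV"

lemma orthonormal_basis_inner:
  assumes "orthonormal_basis B" "b \<in> B" "c \<in> B"
  shows "b \<bullet> c = (if b = c then 1 else 0)"
  using assms unfolding orthonormal_basis_def by blast

lemma orthonormal_basis_finite: "orthonormal_basis B \<Longrightarrow> finite B"
  unfolding orthonormal_basis_def by blast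

lemma orthonormal_basis_norm: "orthonormal_basis B \<Longrightarrow> b \<in> B \<Longrightarrow> b \<bullet> b = 1"
  by (simp add: orthonormal_basis_inner)

lemma orthonormal_basis_expansion:
  assumes "orthonormal_basis B"
  shows "(\<Sum>b\<in>B. (b \<bullet> x) *\<^sub>R b) = x"
proof -
  have "pairwise orthogonal B" "\<And>b. b \<in> B \<Longrightarrow> norm b = 1" "x \<in> span B" "finite B"
    using assms unfolding orthonormal_basis_def pairwise_def orthogonal_def norm_eq_1 by auto
  from orthonormal_basis_expand[OF this] show ?thesis
    by (simp add: inner_commute)
qed

lemma orthonormal_basis_parseval:
  assumes "orthonormal_basis B"
  shows "(\<Sum>b\<in>B. (b \<bullet> x) * (b \<bullet> y)) = x \<bullet> y"
proof -
  have "x \<bullet> y = (\<Sum>b\<in>B. (b \<bullet> x) *\<^sub>R b) \<bullet> y"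
    by (simp add: orthonormal_basis_expansion[OF assms])
  then show ?thesis by (simp add: inner_sum_left)
qed

lemma orthonormal_basis_sum_squares:
  assumes "orthonormal_basis B"
  shows "(\<Sum>b\<in>B. (b \<bullet> x)\<^sup>2) = x \<bullet> x"
  using orthonormal_basis_parseval[OF assms, of x x] by (simp add: power2_eq_square)

lemma orthonormal_basis_eqI:
  assumes "orthonormal_basis B" "\<And>b. b \<in> B \<Longrightarrow> b \<bullet> x = b \<bullet> y"
  shows "x = y"
proof -
  have "(\<Sum>b\<in>B. (b \<bullet> x) *\<^sub>R b) = (\<Sum>b\<in>B. (b \<bullet> y) *\<^sub>R b)"
    using assms(2) by (intro sum.cong) auto
  then show ?thesis by (simp add: orthonormal_basis_expansion[OF assms(1)])
qed

lemma orthonormal_basis_Basis: "orthonormal_basis Basis"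
  unfolding orthonormal_basis_def by (auto simp: inner_Basis)

text \<open>Expanding each \<open>b\<close> in \<open>C\<close> and exchanging the sums leaves an
  inner sum over \<open>B\<close> that Parseval collapses. Hence a trace may be computed in the
  eigenbasis of whichever operator is convenient.\<close>

lemma trace_orthonormal_basis_independent:
  assumes B: "orthonormal_basis B" and C: "orthonormal_basis C" and f: "linear f"
  shows "(\<Sum>b\<in>B. b \<bullet> f b) = (\<Sum>c\<in>C. c \<bullet> f c)"
proof -
  have "(\<Sum>b\<in>B. b \<bullet> f b) = (\<Sum>b\<in>B. b \<bullet> f (\<Sum>c\<in>C. (c \<bullet> b) *\<^sub>R c))"
    by (simp add: orthonormal_basis_expansion[OF C])
  also have "\<dots> = (\<Sum>b\<in>B. \<Sum>c\<in>C. (b \<bullet> c) * (b \<bullet> f c))"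
    by (simp add: linear_sum[OF f] linear_cmul[OF f] inner_sum_right inner_commute)
  also have "\<dots> = (\<Sum>c\<in>C. \<Sum>b\<in>B. (b \<bullet> c) * (b \<bullet> f c))"
    by (rule sum.swap)
  also have "\<dots> = (\<Sum>c\<in>C. c \<bullet> f c)"
    by (simp add: orthonormal_basis_parseval[OF B])
  finally show ?thesis .
qed

subsection \<open>The spectral theorem for real self-adjoint maps\<close>

text \<open>Near \<open>t = 0\<close> the linear term dominates the quadratic one. This is the
  first-order condition at a maximum, obtained without derivatives.\<close>

lemma quadratic_le_imp_zero:
  fixes a c :: real
  assumes "\<And>t. 2 * t * a \<le> t\<^sup>2 * c"
  shows "a = 0"
proof (rule ccontr)
  assume "a \<noteq> 0"
  \<comment> \<open>Any positive \<open>d\<close> above \<open>c\<close> serves: at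
    \<open>t = a / d\<close> the hypothesis gives twice \<open>a * a / d\<close> at most
    \<open>a * a / d\<close>.\<close>
  define d where "d = \<bar>c\<bar> + 1"
  have "d > 0" "c < d" unfolding d_def by auto
  have "2 * (a / d) * a \<le> (a / d)\<^sup>2 * c" by (rule assms)
  also have "\<dots> \<le> (a / d)\<^sup>2 * d"
    using \<open>c < d\<close> by (intro mult_left_mono) auto
  finally have "2 * (a * a / d) \<le> a * a / d"
    using \<open>d > 0\<close> by (simp add: power2_eq_square)
  moreover have "a * a / d > 0"
    using \<open>a \<noteq> 0\<close> \<open>d > 0\<close> by (simp flip: power2_eq_square)
  ultimately show False by linarith
qed

text \<open>The quadratic form attains its maximum on the compact unit sphere of \<open>S\<close>;
  the first-order condition there says that the maximiser is an eigenvector.\<close>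

lemma selfadjoint_eigenvector_exists:
  fixes f :: "'a::euclidean_space \<Rightarrow> 'a"
  assumes f: "linear f" and sa: "\<And>x y. f x \<bullet> y = x \<bullet> f y"
    and S: "subspace S" "f ` S \<subseteq> S" "S \<noteq> {0}"
  obtains u where "u \<in> S" "norm u = 1" "f u = (u \<bullet> f u) *\<^sub>R u"
proof -
  let ?K = "S \<inter> sphere 0 1"
  have "compact ?K"
    by (rule closed_Int_compact) (auto simp: closed_subspace S(1))
  moreover obtain v where "v \<in> S" "v \<noteq> 0" using S subspace_0 by blast
  then have "(1 / norm v) *\<^sub>R v \<in> ?K" using S(1) by (simp add: subspace_mul)
  then have "?K \<noteq> {}" by blast
  moreover have "continuous_on ?K (\<lambda>x. x \<bullet> f x)"
    using f by (intro continuous_on_inner continuous_on_id linear_continuous_on)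
      (simp add: linear_conv_bounded_linear)
  ultimately obtain u where u: "u \<in> ?K" and max: "\<And>x. x \<in> ?K \<Longrightarrow> x \<bullet> f x \<le> u \<bullet> f u"
    using continuous_attains_sup[of ?K "\<lambda>x. x \<bullet> f x"] by blast
  define M where "M = u \<bullet> f u"
  have uS: "u \<in> S" and uu: "u \<bullet> u = 1" using u by (auto simp: norm_eq_1)
  \<comment> \<open>Homogeneity carries the maximum \<open>M\<close> from the unit sphere to all of
    \<open>S\<close>.\<close>
  have le: "x \<bullet> f x \<le> M * (x \<bullet> x)" if "x \<in> S" for x
  proof (cases "x = 0")
    case False
    have "(1 / norm x) *\<^sub>R x \<in> ?K" using False that S(1) by (simp add: subspace_mul)
    from max[OF this] have "(x \<bullet> f x) / (norm x * norm x) \<le> M"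
      by (simp add: linear_cmul[OF f] M_def)
    then show ?thesis using False by (simp add: field_simps dot_square_norm power2_eq_square)
  qed (simp add: linear_0[OF f])
  \<comment> \<open>The residual \<open>w\<close> is orthogonal to \<open>u\<close> and lies in
    \<open>S\<close>, so \<open>u\<close> may be perturbed along it. In \<open>le\<close> at
    \<open>u + t *\<^sub>R w\<close> the constant terms cancel, and self-adjointness makes the
    linear term \<open>2 * t * (w \<bullet> w)\<close>.\<close>
  define w where "w = f u - M *\<^sub>R u"
  have "f u \<in> S" using uS S(2) by blast
  then have wS: "w \<in> S" unfolding w_def using S(1) uS by (simp add: subspace_diff subspace_mul)
  have uw: "u \<bullet> w = 0" by (simp add: w_def inner_diff_right uu M_def)
  have fu: "f u = w + M *\<^sub>R u" by (simp add: w_def)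
  have "w \<bullet> w = 0"
  proof (rule quadratic_le_imp_zero)
    fix t
    have "u + t *\<^sub>R w \<in> S" using S(1) uS wS by (simp add: subspace_add subspace_mul)
    from le[OF this]
    have "(u + t *\<^sub>R w) \<bullet> (f u + t *\<^sub>R f w) \<le> M * ((u + t *\<^sub>R w) \<bullet> (u + t *\<^sub>R w))"
      by (simp add: linear_add[OF f] linear_cmul[OF f])
    moreover have "u \<bullet> f w = w \<bullet> w"
      using sa[of u w] by (simp add: fu inner_add_left uw)
    moreover have wu: "w \<bullet> u = 0"
      using uw by (simp only: inner_commute)
    moreover have "u \<bullet> f u = M" by (simp only: M_def)
    moreover have "w \<bullet> f u = w \<bullet> w" by (simp add: fu inner_add_right wu)
    ultimately show "2 * t * (w \<bullet> w) \<le> t\<^sup>2 * (M * (w \<bullet> w) - w \<bullet> f w)"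
      using uw uu
      by (simp add: inner_add_left inner_add_right algebra_simps power2_eq_square)
  qed
  then have "f u = M *\<^sub>R u" using fu by simp
  with uS uu show ?thesis by (intro that[of u]) (auto simp: M_def norm_eq_1)
qed

text \<open>Induction on dimension: after a unit eigenvector \<open>u\<close> is split off,
  self-adjointness keeps its orthogonal complement in \<open>S\<close> invariant. The general
  invariant \<open>S\<close> is what makes the induction go through.\<close>

lemma selfadjoint_orthonormal_eigenvectors:
  fixes f :: "'a::euclidean_space \<Rightarrow> 'a"
  assumes f: "linear f" and sa: "\<And>x y. f x \<bullet> y = x \<bullet> f y"
    and "subspace S" "f ` S \<subseteq> S"
  shows "\<exists>B. finite B \<and> B \<subseteq> S \<and> (\<forall>b\<in>B. \<forall>c\<in>B. b \<bullet> c = (if b = c then 1 else 0)) \<and>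
      S \<subseteq> span B \<and> (\<forall>b\<in>B. f b = (b \<bullet> f b) *\<^sub>R b)"
  using assms(3,4)
proof (induction "dim S" arbitrary: S rule: less_induct)
  case less
  show ?case
  proof (cases "S = {0}")
    case True
    then show ?thesis by (intro exI[of _ "{}"]) auto
  next
    case False
    obtain u where u: "u \<in> S" "norm u = 1" "f u = (u \<bullet> f u) *\<^sub>R u"
      using selfadjoint_eigenvector_exists[OF f sa less.prems False] by blast
    have uu: "u \<bullet> u = 1" using u(2) by (simp add: norm_eq_1)
    let ?T = "{x \<in> S. u \<bullet> x = 0}"
    have T: "subspace ?T"
      using less.prems(1) by (auto simp: subspace_def inner_add_right)
    have "f ` ?T \<subseteq> ?T"
    proof clarify
      fix x assume x: "x \<in> S" "u \<bullet> x = 0"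
      have "u \<bullet> f x = f u \<bullet> x" by (simp add: sa)
      also have "\<dots> = 0" using u(3) x(2) by (metis inner_scaleR_left mult_zero_right)
      finally show "f x \<in> S \<and> u \<bullet> f x = 0" using x(1) less.prems(2) by blast
    qed
    moreover have "u \<notin> ?T" using uu by simp
    then have "?T \<subset> S" using u(1) by blast
    then have "dim ?T < dim S"
      using T less.prems(1) by (metis dim_psubset span_eq_iff)
    ultimately obtain B where B: "finite B" "B \<subseteq> ?T"
      "\<forall>b\<in>B. \<forall>c\<in>B. b \<bullet> c = (if b = c then 1 else 0)"
      "?T \<subseteq> span B" "\<forall>b\<in>B. f b = (b \<bullet> f b) *\<^sub>R b"
      using less.hyps[of ?T] T by blast
    have "x \<in> span (insert u B)" if "x \<in> S" for x
    proof -
      have "x - (u \<bullet> x) *\<^sub>R u \<in> ?T"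
        using that u(1) less.prems(1) uu
        by (simp add: subspace_diff subspace_mul inner_diff_right)
      then have "x - (u \<bullet> x) *\<^sub>R u \<in> span B" using B(4) by blast
      then show ?thesis by (auto simp: span_insert)
    qed
    moreover have "u \<bullet> b = 0" "b \<bullet> u = 0" if "b \<in> B" for b
      using that B(2) by (auto simp: inner_commute)
    moreover have "u \<notin> B" using uu B(2) by auto
    ultimately show ?thesis
      using B u uu by (intro exI[of _ "insert u B"]) auto
  qed
qed

subsection \<open>Real structure of complex matrices\<close>

lemma matrix_vector_mult_linear_real [simp]: "linear (\<lambda>v. (A::complex^'n^'n) *v v)"
  by (rule linearI)
    (simp_all add: matrix_vector_mult_def vec_eq_iff sum.distrib algebra_simps scaleR_sum_right)

lemma matrix_mult_scaleR: "(A::complex^'n^'n) *v (r *\<^sub>R v) = r *\<^sub>R (A *v v)"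
  by (rule linear_cmul) simp

lemma scaleR_matrix_mult: "(r *\<^sub>R (A::complex^'n^'n)) *v v = r *\<^sub>R (A *v v)"
  by (simp add: matrix_vector_mult_def vec_eq_iff scaleR_sum_right)

lemma sum_matrix_mult: "(\<Sum>i\<in>I. (A i::complex^'n^'n)) *v v = (\<Sum>i\<in>I. A i *v v)"
  by (induction I rule: infinite_finite_induct) (auto simp: matrix_vector_mult_add_rdistrib)

lemma complex_scale_inner: "(c *s u) \<bullet> w = u \<bullet> (cnj c *s (w::complex^'n))"
  by (simp add: inner_vec_def inner_complex_def algebra_simps)

lemma hermitian_selfadjoint:
  fixes A :: "complex^'n^'n"
  assumes "hermitian A"
  shows "(A *v x) \<bullet> y = x \<bullet> (A *v y)"
proof -
  have inner: "u \<bullet> v = Re (\<Sum>i\<in>UNIV. u $ i * cnj (v $ i))" for u v :: "complex^'n"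
    by (simp add: inner_vec_def inner_complex_def)
  have A: "cnj (A $ j $ i) = A $ i $ j" for i j
    using assms unfolding hermitian_def by metis
  have "(\<Sum>i\<in>UNIV. (A *v x) $ i * cnj (y $ i)) =
      (\<Sum>i\<in>UNIV. \<Sum>j\<in>UNIV. A $ i $ j * x $ j * cnj (y $ i))"
    by (simp add: matrix_vector_mult_def sum_distrib_right)
  also have "\<dots> = (\<Sum>j\<in>UNIV. \<Sum>i\<in>UNIV. A $ i $ j * x $ j * cnj (y $ i))"
    by (rule sum.swap)
  also have "\<dots> = (\<Sum>j\<in>UNIV. x $ j * cnj ((A *v y) $ j))"
    by (simp add: matrix_vector_mult_def sum_distrib_left A mult_ac)
  finally show ?thesis by (simp only: inner)
qed

text \<open>The real basis consists of the vectors \<open>axis i 1\<close> and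
  \<open>axis i \<i>\<close>. Each of the two contributes the real part of the diagonal entry,
  whence the factor 2.\<close>

lemma Re_trace_Basis: "(\<Sum>b\<in>Basis. b \<bullet> ((A::complex^'n^'n) *v b)) = 2 * Re (trace A)"
proof -
  have ax: "(A *v axis i c) $ i = A $ i $ i * c" for i c
    by (simp add: matrix_vector_mult_def axis_def if_distrib cong: if_cong)
  have "Basis = (\<lambda>(i::'n, c). axis i c) ` (UNIV \<times> {1, \<i>})"
    by (auto simp: Basis_vec_def Basis_complex_def image_iff)
  moreover have inj: "inj_on (\<lambda>(i::'n, c). axis i c) (UNIV \<times> {1, \<i>})"
    by (auto simp: inj_on_def axis_eq_axis)
  ultimately have "(\<Sum>b\<in>Basis. b \<bullet> (A *v b)) =
      (\<Sum>(i,c)\<in>UNIV \<times> {1, \<i>}. axis i c \<bullet> (A *v axis i c))"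
    using sum.reindex[OF inj, of "\<lambda>b. b \<bullet> (A *v b)"] by (simp add: case_prod_unfold)
  also have "\<dots> = (\<Sum>i\<in>UNIV. \<Sum>c\<in>{1, \<i>}. c \<bullet> (A $ i $ i * c))"
    by (simp only: sum.cartesian_product[symmetric] inner_axis' ax)
  also have "\<dots> = 2 * Re (trace A)"
    by (simp add: inner_complex_def trace_def sum_distrib_left)
  finally show ?thesis .
qed

lemma Re_trace_orthonormal_basis:
  assumes "orthonormal_basis B"
  shows "Re (trace (A::complex^'n^'n)) = (\<Sum>b\<in>B. b \<bullet> (A *v b)) / 2"
  using trace_orthonormal_basis_independent[OF assms orthonormal_basis_Basis, of "\<lambda>v. A *v v"]
  by (simp add: Re_trace_Basis)

section \<open>Orthogonal projections as nearest-point maps\<close>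

lemma closest_point_subspaceI:
  fixes a :: "'a::euclidean_space"
  assumes S: "subspace S" and z: "z \<in> S" and orth: "\<And>w. w \<in> S \<Longrightarrow> (a - z) \<bullet> w = 0"
  shows "closest_point S a = z"
proof (rule closest_point_unique[symmetric])
  show "convex S" "closed S" using S by (auto simp: subspace_imp_convex closed_subspace)
  show "\<forall>w\<in>S. dist a z \<le> dist a w"
  proof
    fix w assume "w \<in> S"
    then have "(a - z) \<bullet> (z - w) = 0" using orth S z by (simp add: subspace_diff)
    moreover have "a - w = (a - z) + (z - w)" by simp
    ultimately have "(norm (a - w))\<^sup>2 = (norm (a - z))\<^sup>2 + (norm (z - w))\<^sup>2"
      by (metis norm_add_Pythagorean orthogonal_def)
    then have "(norm (a - z))\<^sup>2 \<le> (norm (a - w))\<^sup>2" by simp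
    then show "dist a z \<le> dist a w" 
      unfolding dist_norm by (rule power2_le_imp_le) simp
  qed
qed (fact z)

text \<open>The variational inequality of the nearest point holds in both directions
  \<open>w\<close> and \<open>- w\<close>, so it is an equality.\<close>

lemma closest_point_subspace_orthogonal:
  fixes a :: "'a::euclidean_space"
  assumes S: "subspace S" and w: "w \<in> S"
  shows "(a - closest_point S a) \<bullet> w = 0"
proof -
  let ?z = "closest_point S a"
  have cc: "convex S" "closed S" using S by (auto simp: subspace_imp_convex closed_subspace)
  have z: "?z \<in> S" using cc w closest_point_in_set by blast
  have "?z + w \<in> S" "?z - w \<in> S" using S z w by (auto simp: subspace_add subspace_diff)
  from this[THEN closest_point_dot[OF cc], of a] show ?thesis by simp
qed

text \<open>Turning \<open>eigenprojection\<close> back into its nearest-point map requires complex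
  linearity. The nearest point is characterised by an orthogonal residual; sums preserve this, and
  so does scaling by \<open>c\<close>, because its adjoint, scaling by \<open>cnj c\<close>, maps
  \<open>S\<close> into itself.\<close>

lemma closest_point_complex_linear:
  fixes S :: "(complex^'n) set"
  assumes S: "subspace S" and scale: "\<And>c v. v \<in> S \<Longrightarrow> c *s v \<in> S"
  shows "Vector_Spaces.linear (*s) (*s) (closest_point S)"
proof -
  have z: "closest_point S a \<in> S" for a
    using S closed_subspace closest_point_in_set subspace_0 by blast
  show ?thesis
    unfolding Vector_Spaces.linear_def module_hom_def module_hom_axioms_def
  proof (intro conjI allI)
    fix a b :: "complex^'n" and c :: complex
    show "closest_point S (a + b) = closest_point S a + closest_point S b"
    proof (rule closest_point_subspaceI[OF S])
      fix w assume "w \<in> S"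
      then have "(a - closest_point S a) \<bullet> w = 0" "(b - closest_point S b) \<bullet> w = 0"
        using closest_point_subspace_orthogonal[OF S] by auto
      then show "(a + b - (closest_point S a + closest_point S b)) \<bullet> w = 0"
        by (simp add: inner_diff_left inner_add_left)
    qed (use S z in \<open>auto simp: subspace_add\<close>)
    show "closest_point S (c *s a) = c *s closest_point S a"
    proof (rule closest_point_subspaceI[OF S])
      fix w assume "w \<in> S"
      have "c *s a - c *s closest_point S a = c *s (a - closest_point S a)"
        by (simp add: vec_eq_iff algebra_simps)
      then show "(c *s a - c *s closest_point S a) \<bullet> w = 0"
        using closest_point_subspace_orthogonal[OF S scale[OF \<open>w \<in> S\<close>]]
        by (simp only: complex_scale_inner)
    qed (use z scale in auto)
  qed (unfold_locales)
qed

subsection \<open>Eigenbases and the spectral calculus\<close>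

text \<open>The eigenvalues are an explicit function \<open>p\<close> on the basis, so passing to a
  function or a multiple of \<open>A\<close> changes \<open>p\<close> and keeps
  \<open>B\<close>.\<close>

definition eigenbasis ::
  "complex^'n^'n \<Rightarrow> (complex^'n) set \<Rightarrow> (complex^'n \<Rightarrow> real) \<Rightarrow> bool"
where
  "eigenbasis A B p \<longleftrightarrow> orthonormal_basis B \<and> (\<forall>b\<in>B. A *v b = p b *\<^sub>R b)"

lemma eigenbasis_orthonormal: "eigenbasis A B p \<Longrightarrow> orthonormal_basis B"
  unfolding eigenbasis_def by blast

lemma eigenbasis_finite: "eigenbasis A B p \<Longrightarrow> finite B"
  using eigenbasis_orthonormal orthonormal_basis_finite by blast

lemma eigenbasis_norm: "eigenbasis A B p \<Longrightarrow> b \<in> B \<Longrightarrow> b \<bullet> b = 1"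
  using eigenbasis_orthonormal orthonormal_basis_norm by blast

lemma eigenbasis_apply: "eigenbasis A B p \<Longrightarrow> b \<in> B \<Longrightarrow> A *v b = p b *\<^sub>R b"
  unfolding eigenbasis_def by blast

text \<open>Needed for the minimum of the spectrum to be meaningful and for the partition function
  to be positive.\<close>

lemma eigenbasis_nonempty:
  assumes "eigenbasis (A::complex^'n^'n) B p"
  shows "B \<noteq> {}"
proof
  assume "B = {}"
  then have "span {} = (UNIV :: (complex^'n) set)"
    using assms unfolding eigenbasis_def orthonormal_basis_def by blast
  then have "axis undefined 1 = (0 :: complex^'n)" by auto
  then show False by simp
qed

lemma hermitian_eigenbasis:
  assumes "hermitian (A::complex^'n^'n)"
  obtains B p where "eigenbasis A B p"
proof -
  obtain B where "finite B" "\<forall>b\<in>B. \<forall>c\<in>B. b \<bullet> c = (if b = c then 1 else 0)"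
      "UNIV \<subseteq> span B" "\<forall>b\<in>B. A *v b = (b \<bullet> (A *v b)) *\<^sub>R b"
    using selfadjoint_orthonormal_eigenvectors[of "\<lambda>v. A *v v" UNIV]
      hermitian_selfadjoint[OF assms] by auto
  then show ?thesis
    by (intro that[of B "\<lambda>b. b \<bullet> (A *v b)"])
      (auto simp: eigenbasis_def orthonormal_basis_def)
qed

lemma eigenbasis_inner:
  assumes e: "eigenbasis A B p" and b: "b \<in> B"
  shows "b \<bullet> (A *v v) = p b * (b \<bullet> v)"
proof -
  have "A *v v = A *v (\<Sum>c\<in>B. (c \<bullet> v) *\<^sub>R c)"
    by (simp add: orthonormal_basis_expansion[OF eigenbasis_orthonormal[OF e]])
  also have "\<dots> = (\<Sum>c\<in>B. (c \<bullet> v) *\<^sub>R (A *v c))"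
    by (simp only: linear_sum[OF matrix_vector_mult_linear_real] matrix_mult_scaleR)
  also have "b \<bullet> \<dots> = (\<Sum>c\<in>B. if c = b then p b * (b \<bullet> v) else 0)"
    unfolding inner_sum_right
    by (intro sum.cong refl)
      (simp add: eigenbasis_apply[OF e] orthonormal_basis_inner[OF eigenbasis_orthonormal[OF e] b])
  finally show ?thesis using b eigenbasis_finite[OF e] by simp
qed

lemma eigenbasis_quadratic_form:
  assumes "eigenbasis A B p"
  shows "v \<bullet> (A *v v) = (\<Sum>b\<in>B. p b * (b \<bullet> v)\<^sup>2)"
  using orthonormal_basis_parseval[OF eigenbasis_orthonormal[OF assms], of v "A *v v"]
  by (simp add: eigenbasis_inner[OF assms] power2_eq_square mult_ac)

lemma eigenspace_subspace: "subspace (eigenspace A x)"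
  unfolding subspace_def eigenspace_def
  by (auto simp: matrix_vector_right_distrib matrix_mult_scaleR scaleR_right_distrib)

lemma eigenspace_complex_scale: "v \<in> eigenspace A x \<Longrightarrow> c *s v \<in> eigenspace A x"
  unfolding eigenspace_def
  by (simp add: vector_scalar_commute) (simp add: vec_eq_iff)

lemma eigenspace_orthogonal:
  assumes "eigenbasis A B p" "b \<in> B" "p b \<noteq> x" "v \<in> eigenspace A x"
  shows "b \<bullet> v = 0"
  using eigenbasis_inner[OF assms(1,2), of v] assms(3,4) by (simp add: eigenspace_def)

text \<open>A nonzero eigenvector overlaps with some \<open>b\<close>, and orthogonality of distinct
  eigenspaces then forces its eigenvalue to be \<open>p b\<close>.\<close>

lemma eigenbasis_eigenvalues:
  assumes e: "eigenbasis A B p"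
  shows "eigenvalues A = p ` B"
proof (intro equalityI subsetI)
  fix x assume "x \<in> eigenvalues A"
  then obtain v where v: "v \<in> eigenspace A x" "v \<noteq> 0" unfolding eigenvalues_def by blast
  then obtain b where "b \<in> B" "b \<bullet> v \<noteq> 0"
    using orthonormal_basis_eqI[OF eigenbasis_orthonormal[OF e], of v 0] by auto
  then have "x = p b" using eigenspace_orthogonal[OF e] v(1) by metis
  then show "x \<in> p ` B" using \<open>b \<in> B\<close> by blast
next
  fix x assume "x \<in> p ` B"
  then obtain b where b: "b \<in> B" "x = p b" by blast
  then have "b \<in> eigenspace A x" using eigenbasis_apply[OF e] by (simp add: eigenspace_def)
  moreover have "b \<noteq> 0" using eigenbasis_norm[OF e b(1)] by auto
  ultimately show "x \<in> eigenvalues A" unfolding eigenvalues_def by blast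
qed

lemma eigenprojection_eigenbasis:
  assumes e: "eigenbasis A B p" and b: "b \<in> B"
  shows "eigenprojection A x *v b = (if p b = x then b else 0)"
proof -
  have "eigenprojection A x *v b = closest_point (eigenspace A x) b"
    unfolding eigenprojection_def
    by (intro matrix_works closest_point_complex_linear eigenspace_subspace
        eigenspace_complex_scale)
  also have "\<dots> = (if p b = x then b else 0)"
  proof (cases "p b = x")
    case True
    then have "b \<in> eigenspace A x" using eigenbasis_apply[OF e b] by (simp add: eigenspace_def)
    then show ?thesis using True by (simp add: closest_point_self)
  next
    case False
    then show ?thesis
      using eigenspace_orthogonal[OF e b]
      by (simp add: closest_point_subspaceI eigenspace_subspace subspace_0)
  qed
  finally show ?thesis .
qed

text \<open>The bridge from the projection-based definition to diagonal form; later arguments about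
  the exponential and the logarithm use only this.\<close>

lemma spectral_fun_eigenbasis:
  assumes e: "eigenbasis A B p"
  shows "eigenbasis (spectral_fun f A) B (\<lambda>b. f (p b))"
  unfolding eigenbasis_def
proof (intro conjI ballI)
  fix b assume b: "b \<in> B"
  \<comment> \<open>The sum runs over distinct eigenvalues, so exactly one term survives even when
    \<open>p\<close> repeats values.\<close>
  have "spectral_fun f A *v b = (\<Sum>x\<in>p ` B. if x = p b then f x *\<^sub>R b else 0)"
    unfolding spectral_fun_def sum_matrix_mult scaleR_matrix_mult eigenbasis_eigenvalues[OF e]
    by (intro sum.cong refl) (simp add: eigenprojection_eigenbasis[OF e b])
  then show "spectral_fun f A *v b = f (p b) *\<^sub>R b"
    using b eigenbasis_finite[OF e] by simp
qed (fact eigenbasis_orthonormal[OF e])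

lemma eigenbasis_scaleR:
  "eigenbasis A B p \<Longrightarrow> eigenbasis (r *\<^sub>R A) B (\<lambda>b. r * p b)"
  unfolding eigenbasis_def by (simp add: scaleR_matrix_mult)

lemma eigenbasis_trace:
  assumes "eigenbasis A B p"
  shows "Re (trace A) = (\<Sum>b\<in>B. p b) / 2"
  unfolding Re_trace_orthonormal_basis[OF eigenbasis_orthonormal[OF assms]]
  by (simp add: eigenbasis_inner[OF assms] eigenbasis_norm[OF assms])

lemma eigenbasis_expval:
  assumes "eigenbasis \<rho> B p"
  shows "expval A \<rho> = (\<Sum>b\<in>B. p b * (b \<bullet> (A *v b))) / 2"
  unfolding expval_def Re_trace_orthonormal_basis[OF eigenbasis_orthonormal[OF assms]]
  by (simp add: matrix_vector_mul_assoc[symmetric] eigenbasis_apply[OF assms] matrix_mult_scaleR)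

lemma eigenbasis_entropy:
  assumes "eigenbasis \<rho> B p"
  shows "entropy \<rho> = - (\<Sum>b\<in>B. p b * ln (p b)) / 2"
  unfolding entropy_def
    Re_trace_orthonormal_basis[OF eigenbasis_orthonormal[OF assms]]
  by (simp add: matrix_vector_mul_assoc[symmetric] eigenbasis_norm[OF assms]
      eigenbasis_apply[OF assms] eigenbasis_apply[OF spectral_fun_eigenbasis[OF assms]]
      matrix_mult_scaleR mult_ac)

subsection \<open>States and expectation values\<close>

lemma psd_hermitian: "psd A \<Longrightarrow> hermitian A"
  unfolding psd_def by blast

lemma psd_eigenbasis:
  assumes "psd (A::complex^'n^'n)"
  obtains B p where "eigenbasis A B p"
  using hermitian_eigenbasis[OF psd_hermitian[OF assms]] .

lemma psd_eigenvalue_nonneg: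
  assumes "psd A" "eigenbasis A B p" "b \<in> B"
  shows "0 \<le> p b"
proof -
  have "0 \<le> b \<bullet> (A *v b)" using assms(1) unfolding psd_def by blast
  then show ?thesis
    using assms by (simp add: eigenbasis_inner eigenbasis_norm)
qed

lemma state_psd: "is_state \<rho> \<Longrightarrow> psd \<rho>"
  unfolding is_state_def by blast

lemma state_eigenbasis:
  assumes "is_state (\<rho>::complex^'n^'n)"
  obtains B p where "eigenbasis \<rho> B p"
  using psd_eigenbasis[OF state_psd[OF assms]] .

lemma state_eigenvalue_sum:
  assumes "is_state \<rho>" "eigenbasis \<rho> B p"
  shows "(\<Sum>b\<in>B. p b) = 2"
  using eigenbasis_trace[OF assms(2)] assms(1) unfolding is_state_def by simp

text \<open>Over the reals every eigenvalue occurs twice, for \<open>b\<close> and for \<open>\<i>b\<close>; hence the bound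
  is 1 although the eigenvalues over a real basis sum to 2.\<close>

lemma state_eigenvalue_le_1:
  assumes s: "is_state \<rho>" and e: "eigenbasis \<rho> B p" and b: "b \<in> B"
  shows "p b \<le> 1"
proof -
  define d where "d = \<i> *s b"
  have bb: "b \<bullet> b = 1" by (rule eigenbasis_norm[OF e b])
  have dd: "d \<bullet> d = 1" using bb by (simp add: d_def inner_vec_def inner_complex_def add.commute)
  have bd: "b \<bullet> d = 0" by (simp add: d_def inner_vec_def inner_complex_def)
  have "\<rho> *v d = p b *\<^sub>R d"
    using eigenbasis_apply[OF e b] by (simp add: d_def vector_scalar_commute vec_eq_iff)
  then have "p b + p b = b \<bullet> (\<rho> *v b) + d \<bullet> (\<rho> *v d)"
    using bb dd by (simp add: eigenbasis_apply[OF e b])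
  also have "\<dots> = (\<Sum>c\<in>B. p c * ((c \<bullet> b)\<^sup>2 + (c \<bullet> d)\<^sup>2))"
    by (simp add: eigenbasis_quadratic_form[OF e] sum.distrib distrib_left)
  also have "\<dots> \<le> (\<Sum>c\<in>B. p c * 1)"
  proof (intro sum_mono mult_left_mono)
    fix c assume c: "c \<in> B"
    show "0 \<le> p c" using psd_eigenvalue_nonneg[OF state_psd[OF s] e c] .
    \<comment> \<open>Bessel's inequality for the orthonormal pair \<open>b\<close>,
      \<open>d\<close>: \<open>r\<close> is what remains of \<open>c\<close> after removing its
      components along them.\<close>
    define r where "r = c - (c \<bullet> b) *\<^sub>R b - (c \<bullet> d) *\<^sub>R d"
    have "r \<bullet> r = c \<bullet> c - (c \<bullet> b)\<^sup>2 - (c \<bullet> d)\<^sup>2"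
      using bb dd bd unfolding r_def
      by (simp add: inner_diff_left inner_diff_right inner_commute power2_eq_square)
    then show "(c \<bullet> b)\<^sup>2 + (c \<bullet> d)\<^sup>2 \<le> 1"
      using eigenbasis_norm[OF e c] inner_ge_zero[of r] by linarith
  qed
  also have "\<dots> = 2" using state_eigenvalue_sum[OF s e] by simp
  finally show ?thesis by simp
qed

lemma state_entropy_nonneg:
  assumes "is_state \<rho>"
  shows "0 \<le> entropy \<rho>"
proof -
  obtain B p where e: "eigenbasis \<rho> B p"
    by (rule state_eigenbasis[OF assms])
  have "p b * ln (p b) \<le> 0" if "b \<in> B" for b
    using psd_eigenvalue_nonneg[OF state_psd[OF assms] e that] state_eigenvalue_le_1[OF assms e that]
    by (cases "p b = 0") (auto simp: mult_le_0_iff)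
  then have "(\<Sum>b\<in>B. p b * ln (p b)) \<le> 0" by (simp add: sum_nonpos)
  then show ?thesis by (simp add: eigenbasis_entropy[OF e])
qed

text \<open>Eigenvalues of a state are at most 1. The bound is uniform over states, which makes the
  suprema over \<open>L\<close> well behaved.\<close>

lemma expval_le_trace:
  assumes "psd A" "is_state \<rho>"
  shows "expval A \<rho> \<le> Re (trace A)"
proof -
  obtain B p where e: "eigenbasis \<rho> B p"
    by (rule state_eigenbasis[OF assms(2)])
  have "(\<Sum>b\<in>B. p b * (b \<bullet> (A *v b))) \<le> (\<Sum>b\<in>B. 1 * (b \<bullet> (A *v b)))"
    using assms(1) state_eigenvalue_le_1[OF assms(2) e]
    by (intro sum_mono mult_right_mono) (auto simp: psd_def)
  then show ?thesis
    by (simp add: eigenbasis_expval[OF e] Re_trace_orthonormal_basis[OF eigenbasis_orthonormal[OF e]])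
qed

lemma Min_eigenvalues_nonneg:
  assumes "psd A"
  shows "0 \<le> Min (eigenvalues A)"
proof -
  obtain B p where e: "eigenbasis A B p"
    by (rule psd_eigenbasis[OF assms])
  then show ?thesis
    using psd_eigenvalue_nonneg[OF assms e]
    by (simp add: eigenbasis_eigenvalues[OF e] eigenbasis_finite[OF e] eigenbasis_nonempty[OF e])
qed

text \<open>In an eigenbasis of \<open>A\<close> the quadratic form at a unit vector averages the
  eigenvalues with weights summing to 1; the expectation value averages these forms in turn.\<close>

lemma Min_eigenvalues_le_expval:
  assumes A: "hermitian A" and s: "is_state \<rho>"
  shows "Min (eigenvalues A) \<le> expval A \<rho>"
proof -
  obtain C h where a: "eigenbasis A C h"
    by (rule hermitian_eigenbasis[OF A])
  obtain B p where e: "eigenbasis \<rho> B p"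
    by (rule state_eigenbasis[OF s])
  let ?m = "Min (eigenvalues A)"
  have m: "?m \<le> b \<bullet> (A *v b)" if b: "b \<in> B" for b
  proof -
    have "?m = (\<Sum>c\<in>C. ?m * (c \<bullet> b)\<^sup>2)"
      by (simp add: sum_distrib_left[symmetric]
          orthonormal_basis_sum_squares[OF eigenbasis_orthonormal[OF a]] eigenbasis_norm[OF e b])
    also have "\<dots> \<le> (\<Sum>c\<in>C. h c * (c \<bullet> b)\<^sup>2)"
      by (intro sum_mono mult_right_mono)
        (auto simp: eigenbasis_eigenvalues[OF a] eigenbasis_finite[OF a])
    finally show ?thesis by (simp add: eigenbasis_quadratic_form[OF a])
  qed
  have "?m = (\<Sum>b\<in>B. p b * ?m) / 2"
    by (simp add: sum_distrib_right[symmetric] state_eigenvalue_sum[OF s e])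
  also have "\<dots> \<le> expval A \<rho>"
    unfolding eigenbasis_expval[OF e]
    using m psd_eigenvalue_nonneg[OF state_psd[OF s] e]
    by (intro divide_right_mono sum_mono mult_left_mono) auto
  finally show ?thesis .
qed

text \<open>The norm is the Frobenius norm, whose square at a Hermitian \<rho> is the trace of its
  square, hence at most the trace of \<rho>.\<close>

lemma state_norm_le_1:
  assumes "is_state \<rho>"
  shows "norm \<rho> \<le> 1"
proof -
  have h: "\<rho> $ j $ i = cnj (\<rho> $ i $ j)" for i j
    using psd_hermitian[OF state_psd[OF assms]] unfolding hermitian_def by metis
  have "Re (\<rho> $ i $ j * \<rho> $ j $ i) = \<rho> $ i $ j \<bullet> \<rho> $ i $ j" for i j
    by (simp add: h[of j i] inner_complex_def)
  then have "\<rho> \<bullet> \<rho> = expval \<rho> \<rho>"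
    by (simp only: expval_def trace_def matrix_matrix_mult_def inner_vec_def vec_lambda_beta Re_sum)
  also have "\<dots> \<le> 1"
    using expval_le_trace[OF state_psd[OF assms] assms] assms by (simp add: is_state_def)
  finally show ?thesis by (simp add: norm_le_square)
qed

subsection \<open>Gibbs' variational principle\<close>

text \<open>For positive \<open>p\<close> the expression is \<open>p * (x - 1 - ln x)\<close> at
  \<open>x = q / p\<close>, and \<open>ln x\<close> meets its tangent \<open>x - 1\<close> only at
  1. For \<open>p = 0\<close> it is just \<open>q\<close>, which is positive.\<close>

lemma relative_entropy_term_nonneg:
  fixes p q :: real
  assumes "0 \<le> p" "0 < q"
  shows "0 \<le> p * ln p - p * ln q - p + q"
    and "p * ln p - p * ln q - p + q = 0 \<Longrightarrow> p = q"
proof -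
  have "0 \<le> p * ln p - p * ln q - p + q \<and> (p * ln p - p * ln q - p + q = 0 \<longrightarrow> p = q)"
  proof (cases "p = 0")
    case False
    then have p: "0 < p" using assms by simp
    have eq: "p * ln p - p * ln q - p + q = p * (q / p - 1 - ln (q / p))"
      using p assms by (simp add: ln_div field_simps)
    have "ln (q / p) \<le> q / p - 1" using p assms by (intro ln_le_minus_one) simp
    moreover have "q / p = 1" if "ln (q / p) = q / p - 1"
      using that p assms by (intro ln_eq_minus_one) simp_all
    ultimately show ?thesis unfolding eq using p by auto
  qed (use assms in auto)
  then show "0 \<le> p * ln p - p * ln q - p + q"
    "p * ln p - p * ln q - p + q = 0 \<Longrightarrow> p = q" by auto
qed

text \<open>The denominator is the partition function; halving corrects for the doubled real
  eigenbasis.\<close>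

lemma thermal_state_eigenbasis:
  assumes "eigenbasis H C h"
  shows "eigenbasis (thermal_state \<beta> H) C
    (\<lambda>c. exp (- \<beta> * h c) / ((\<Sum>c\<in>C. exp (- \<beta> * h c)) / 2))"
proof -
  note e = spectral_fun_eigenbasis[OF eigenbasis_scaleR[OF assms, of "- \<beta>"], of exp]
  have "thermal_state \<beta> H =
      inverse ((\<Sum>c\<in>C. exp (- \<beta> * h c)) / 2) *\<^sub>R spectral_fun exp ((- \<beta>) *\<^sub>R H)"
    unfolding thermal_state_def Let_def eigenbasis_trace[OF e] ..
  then show ?thesis
    using eigenbasis_scaleR[OF e, of "inverse ((\<Sum>c\<in>C. exp (- \<beta> * h c)) / 2)"]
    by (simp only: divide_inverse mult.commute)
qed

text \<open>The right-hand side is the relative entropy of \<sigma> to the thermal state, written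
  with the overlaps \<open>(b \<bullet> c)\<^sup>2\<close>, whose rows and columns sum to 1. The
  terms \<open>- p b + q c\<close> cancel in total but make each summand nonnegative.\<close>

lemma work_cost_eigenbasis:
  assumes \<beta>: "0 < \<beta>" and H: "eigenbasis H C h" and s: "is_state \<sigma>" and e: "eigenbasis \<sigma> B p"
    and q: "eigenbasis (thermal_state \<beta> H) C q"
  shows "\<beta> * work_cost \<beta> H \<sigma> =
    (\<Sum>b\<in>B. \<Sum>c\<in>C. (b \<bullet> c)\<^sup>2 * (p b * ln (p b) - p b * ln (q c) - p b + q c)) / 2"
    and "c \<in> C \<Longrightarrow> 0 < q c"
proof -
  define Z where "Z = (\<Sum>c\<in>C. exp (- \<beta> * h c)) / 2"
  have Z: "0 < Z" unfolding Z_def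
    using eigenbasis_finite[OF H] eigenbasis_nonempty[OF H] by (simp add: sum_pos)
  \<comment> \<open>The given \<open>q\<close> must agree with the Gibbs weights, since a nonzero
    vector has only one eigenvalue.\<close>
  have qc: "q c = exp (- \<beta> * h c) / Z" if c: "c \<in> C" for c
  proof -
    have "q c *\<^sub>R c = (exp (- \<beta> * h c) / Z) *\<^sub>R c"
      using eigenbasis_apply[OF q c] eigenbasis_apply[OF thermal_state_eigenbasis[OF H] c, of \<beta>]
      unfolding Z_def by metis
    moreover have "c \<noteq> 0" using eigenbasis_norm[OF H c] by auto
    ultimately show ?thesis by simp
  qed
  show "0 < q c" if "c \<in> C" for c using qc[OF that] Z by simp
  have lnq: "ln (q c) = - \<beta> * h c - ln Z" if "c \<in> C" for c
    using Z by (simp add: qc[OF that] ln_div)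
  have "(\<Sum>c\<in>C. q c) = (\<Sum>c\<in>C. exp (- \<beta> * h c)) / Z"
    by (simp add: qc sum_divide_distrib)
  also have "\<dots> = 2" using Z by (simp add: Z_def)
  finally have sumq: "(\<Sum>c\<in>C. q c) = 2" .
  have sump: "(\<Sum>b\<in>B. p b) = 2" by (rule state_eigenvalue_sum[OF s e])
  have rowC: "(\<Sum>c\<in>C. (b \<bullet> c)\<^sup>2) = 1" if "b \<in> B" for b
    using orthonormal_basis_sum_squares[OF eigenbasis_orthonormal[OF H], of b]
      eigenbasis_norm[OF e that] by (simp add: inner_commute)
  have rowB: "(\<Sum>b\<in>B. (b \<bullet> c)\<^sup>2) = 1" if "c \<in> C" for c
    using orthonormal_basis_sum_squares[OF eigenbasis_orthonormal[OF e], of c]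
      eigenbasis_norm[OF H that] by simp
  define E where "E = expval H (thermal_state \<beta> H)"
  have E: "E = (\<Sum>c\<in>C. q c * h c) / 2"
    by (simp add: E_def eigenbasis_expval[OF q] eigenbasis_inner[OF H] eigenbasis_norm[OF H])
  have "(\<Sum>c\<in>C. q c * ln (q c)) = (\<Sum>c\<in>C. (- \<beta>) * (q c * h c) - q c * ln Z)"
    by (intro sum.cong refl) (simp add: lnq algebra_simps)
  also have "\<dots> = (- \<beta>) * (\<Sum>c\<in>C. q c * h c) - (\<Sum>c\<in>C. q c) * ln Z"
    by (simp only: sum_subtractf sum_distrib_left sum_distrib_right)
  finally have "entropy (thermal_state \<beta> H) = \<beta> * E + ln Z"
    by (simp add: eigenbasis_entropy[OF q] sumq E field_simps)
  \<comment> \<open>The energy of the thermal state cancels, leaving minus the log partition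
    function, which also appears in \<open>lnq\<close>.\<close>
  then have F: "\<beta> * free_energy \<beta> H (thermal_state \<beta> H) = - ln Z"
    using \<beta> by (simp add: free_energy_def E_def[symmetric] field_simps)
  have \<sigma>: "\<beta> * free_energy \<beta> H \<sigma> = \<beta> * expval H \<sigma> - entropy \<sigma>"
    using \<beta> by (simp add: free_energy_def field_simps)
  have 1: "(\<Sum>b\<in>B. \<Sum>c\<in>C. (b \<bullet> c)\<^sup>2 * (p b * ln (p b))) = - 2 * entropy \<sigma>"
    by (simp add: sum_distrib_right[symmetric] rowC eigenbasis_entropy[OF e])
  have 2: "(\<Sum>b\<in>B. \<Sum>c\<in>C. (b \<bullet> c)\<^sup>2 * p b) = 2"
    by (simp add: sum_distrib_right[symmetric] rowC sump)
  have 3: "(\<Sum>b\<in>B. \<Sum>c\<in>C. (b \<bullet> c)\<^sup>2 * q c) = 2"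
    by (subst sum.swap) (simp add: sum_distrib_right[symmetric] rowB sumq)
  have 4: "(\<Sum>b\<in>B. \<Sum>c\<in>C. (b \<bullet> c)\<^sup>2 * (p b * h c)) = 2 * expval H \<sigma>"
    by (simp add: eigenbasis_expval[OF e] eigenbasis_quadratic_form[OF H] sum_distrib_left
        inner_commute mult_ac)
  have "(\<Sum>b\<in>B. \<Sum>c\<in>C. (b \<bullet> c)\<^sup>2 * (p b * ln (p b) - p b * ln (q c) - p b + q c)) =
      (\<Sum>b\<in>B. \<Sum>c\<in>C. (b \<bullet> c)\<^sup>2 * (p b * ln (p b)) + \<beta> * ((b \<bullet> c)\<^sup>2 * (p b * h c))
        + ln Z * ((b \<bullet> c)\<^sup>2 * p b) - (b \<bullet> c)\<^sup>2 * p b + (b \<bullet> c)\<^sup>2 * q c)"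
    by (intro sum.cong refl) (simp add: lnq algebra_simps)
  also have "\<dots> = - 2 * entropy \<sigma> + \<beta> * (2 * expval H \<sigma>) + ln Z * 2"
    by (simp add: sum.distrib sum_subtractf sum_distrib_left[symmetric] 1 2 3 4)
  also have "\<dots> = 2 * (\<beta> * work_cost \<beta> H \<sigma>)"
    using F \<sigma> by (simp add: work_cost_def right_diff_distrib)
  finally show "\<beta> * work_cost \<beta> H \<sigma> =
    (\<Sum>b\<in>B. \<Sum>c\<in>C. (b \<bullet> c)\<^sup>2 * (p b * ln (p b) - p b * ln (q c) - p b + q c)) / 2" by simp
qed

text \<open>Klein's inequality, summand by summand. At equality every summand vanishes, which fixes
  all matrix elements of \<sigma> between the two eigenbases.\<close>

lemma work_cost_nonneg_and_zero:
  assumes \<beta>: "0 < \<beta>" and H: "hermitian H" and s: "is_state \<sigma>"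
  shows work_cost_nonneg: "0 \<le> work_cost \<beta> H \<sigma>"
    and work_cost_zero_imp: "work_cost \<beta> H \<sigma> = 0 \<Longrightarrow> \<sigma> = thermal_state \<beta> H"
proof -
  obtain C h where h: "eigenbasis H C h"
    by (rule hermitian_eigenbasis[OF H])
  obtain B p where e: "eigenbasis \<sigma> B p"
    by (rule state_eigenbasis[OF s])
  obtain q where q: "eigenbasis (thermal_state \<beta> H) C q"
    using thermal_state_eigenbasis[OF h] by blast
  note W = work_cost_eigenbasis[OF \<beta> h s e q]
  let ?t = "\<lambda>b c. p b * ln (p b) - p b * ln (q c) - p b + q c"
  note p0 = psd_eigenvalue_nonneg[OF state_psd[OF s] e]
  have nn: "0 \<le> (b \<bullet> c)\<^sup>2 * ?t b c" if "b \<in> B" "c \<in> C" for b c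
    using relative_entropy_term_nonneg(1)[OF p0[OF that(1)] W(2)[OF that(2)]] by simp
  have "0 \<le> \<beta> * work_cost \<beta> H \<sigma>"
    unfolding W(1) using nn by (intro divide_nonneg_nonneg sum_nonneg) auto
  then show "0 \<le> work_cost \<beta> H \<sigma>" using \<beta> by (simp add: zero_le_mult_iff)
  assume "work_cost \<beta> H \<sigma> = 0"
  then have "(\<Sum>b\<in>B. \<Sum>c\<in>C. (b \<bullet> c)\<^sup>2 * ?t b c) = 0" using W(1) by simp
  then have *: "\<forall>b\<in>B. (\<Sum>c\<in>C. (b \<bullet> c)\<^sup>2 * ?t b c) = 0"
    using nn eigenbasis_finite[OF e] by (subst (asm) sum_nonneg_eq_0_iff) (auto intro: sum_nonneg)
  then have zero: "(b \<bullet> c)\<^sup>2 * ?t b c = 0" if "b \<in> B" "c \<in> C" for b c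
  proof -
    have "(\<Sum>c\<in>C. (b \<bullet> c)\<^sup>2 * ?t b c) = 0" using that(1) * by blast
    then show ?thesis
      using sum_nonneg_0[where f = "\<lambda>c. (b \<bullet> c)\<^sup>2 * ?t b c"] eigenbasis_finite[OF h] nn that
      by blast
  qed
  have "\<sigma> *v c = thermal_state \<beta> H *v c" if c: "c \<in> C" for c
  proof (rule orthonormal_basis_eqI[OF eigenbasis_orthonormal[OF e]])
    fix b assume b: "b \<in> B"
    \<comment> \<open>Either the overlap is zero or the equality case gives
      \<open>p b = q c\<close>.\<close>
    have "p b * (b \<bullet> c) = q c * (b \<bullet> c)"
      using zero[OF b c] relative_entropy_term_nonneg(2)[OF p0[OF b] W(2)[OF c]] by auto
    then show "b \<bullet> (\<sigma> *v c) = b \<bullet> (thermal_state \<beta> H *v c)"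
      by (simp add: eigenbasis_inner[OF e b] eigenbasis_apply[OF q c])
  qed
  then have "\<sigma> *v (\<Sum>c\<in>C. (c \<bullet> v) *\<^sub>R c) = thermal_state \<beta> H *v (\<Sum>c\<in>C. (c \<bullet> v) *\<^sub>R c)" for v
    by (simp add: linear_sum[OF matrix_vector_mult_linear_real] matrix_mult_scaleR)
  then show "\<sigma> = thermal_state \<beta> H"
    by (simp add: matrix_eq orthonormal_basis_expansion[OF eigenbasis_orthonormal[OF h]])
qed

lemma expval_thermal_state_nonneg:
  assumes "psd H"
  shows "0 \<le> expval H (thermal_state \<beta> H)"
proof -
  obtain C h where h: "eigenbasis H C h"
    by (rule psd_eigenbasis[OF assms])
  show ?thesis
    unfolding eigenbasis_expval[OF thermal_state_eigenbasis[OF h]]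
    using assms by (intro divide_nonneg_nonneg sum_nonneg mult_nonneg_nonneg) (auto simp: psd_def)
qed

subsection \<open>Robustness and relative cost\<close>

lemma robustness_nonneg: "0 \<le> robustness L \<rho>"
  unfolding robustness_def by (rule INF_greatest) simp

text \<open>With robustness zero, arbitrarily small admixtures \<open>s\<close> would put free
  states arbitrarily close to \<rho>, and \<open>L\<close> is closed. This works with the infimum
  directly, without attainment.\<close>

lemma robustness_pos:
  assumes L: "free_states L" and \<rho>: "is_state \<rho>" "\<rho> \<notin> L"
  shows "0 < robustness L \<rho>"
proof (rule ccontr)
  assume "\<not> ?thesis"
  then have R: "robustness L \<rho> = 0" using robustness_nonneg[of L \<rho>] by simp
  have "\<exists>\<sigma>\<in>L. dist \<sigma> \<rho> < e" if e: "0 < e" for e :: real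
  proof -
    have "robustness L \<rho> < ereal (e / 2)" using R e by simp
    then obtain s \<gamma> where s: "0 \<le> s" "s < e / 2" and \<gamma>: "is_state \<gamma>"
        and mem: "inverse (1 + s) *\<^sub>R (\<rho> + s *\<^sub>R \<gamma>) \<in> L"
      unfolding robustness_def INF_less_iff by auto
    let ?\<sigma> = "inverse (1 + s) *\<^sub>R (\<rho> + s *\<^sub>R \<gamma>)"
    \<comment> \<open>The mixture is displaced from \<rho> by \<open>s / (1 + s)\<close> times a
      difference of two states, which has norm at most 2.\<close>
    have "?\<sigma> - \<rho> = inverse (1 + s) *\<^sub>R (\<rho> + s *\<^sub>R \<gamma> - (1 + s) *\<^sub>R \<rho>)"
      using s(1) by (simp only: scaleR_diff_right scaleR_scaleR) simp
    also have "\<dots> = (s * inverse (1 + s)) *\<^sub>R (\<gamma> - \<rho>)"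
      by (simp add: scaleR_add_left scaleR_diff_right mult.commute)
    finally have "dist ?\<sigma> \<rho> = s * inverse (1 + s) * norm (\<gamma> - \<rho>)"
      using s(1) by (simp add: dist_norm)
    also have "\<dots> \<le> s * 1 * 2"
    proof (intro mult_mono)
      show "inverse (1 + s) \<le> 1" using s(1) by (simp add: inverse_le_1_iff)
      show "norm (\<gamma> - \<rho>) \<le> 2"
        using norm_triangle_ineq4[of \<gamma> \<rho>] state_norm_le_1[OF \<gamma>] state_norm_le_1[OF \<rho>(1)]
        by linarith
    qed (use s(1) in auto)
    also have "\<dots> < e" using s(2) by simp
    finally show ?thesis using mem by blast
  qed
  then have "\<rho> \<in> closure L" by (simp add: closure_approachable)
  then show False using L \<rho>(2) by (simp add: free_states_def)
qed

section \<open>Upper bounds on the relative cost from a single Hamiltonian\<close>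

text \<open>One admissible \<open>H\<close> bounds the infimum once the ratios are known to be
  bounded below, here by 0. Keeping \<open>W\<close> abstract serves both temperature
  regimes.\<close>

lemma relative_cost_le:
  assumes L: "L \<noteq> {}"
    and bdd: "\<And>H. psd H \<Longrightarrow> bdd_above (W H ` L)"
    and nonneg: "\<And>H \<sigma>. psd H \<Longrightarrow> \<sigma> \<in> L \<Longrightarrow> 0 \<le> W H \<sigma>" "\<And>H. psd H \<Longrightarrow> 0 \<le> W H \<rho>"
    and H: "psd H" "W H \<rho> \<noteq> 0" and M: "\<And>\<sigma>. \<sigma> \<in> L \<Longrightarrow> W H \<sigma> \<le> M"
  shows "relative_cost W L \<rho> \<le> M / W H \<rho>"
proof -
  let ?r = "\<lambda>H. (SUP \<sigma>\<in>L. W H \<sigma>) / W H \<rho>"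
  have "0 \<le> ?r H" if "psd H" for H
  proof -
    obtain \<sigma> where "\<sigma> \<in> L" using L by blast
    then have "0 \<le> (SUP \<sigma>\<in>L. W H \<sigma>)"
      using nonneg(1) bdd that by (meson cSUP_upper2)
    then show ?thesis using nonneg(2) that by simp
  qed
  then have "bdd_below (?r ` {H. psd H \<and> W H \<rho> \<noteq> 0})" by (intro bdd_belowI2[of _ 0]) auto
  then have "relative_cost W L \<rho> \<le> ?r H"
    unfolding relative_cost_def using H by (intro cINF_lower) auto
  also have "\<dots> \<le> M / W H \<rho>"
    using L M nonneg(2)[OF H(1)] by (intro divide_right_mono cSUP_least)
  finally show ?thesis .
qed

text \<open>Cross-multiplication leaves \<open>c * (b - a)\<close>. The role of \<open>c\<close> is
  played by the thermal energy at positive temperature and by the smallest eigenvalue at zero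
  temperature.\<close>

lemma diff_divide_diff_le:
  fixes a b c :: real
  assumes "0 \<le> c" "a \<le> b" "0 < b - c"
  shows "(a - c) / (b - c) \<le> a / b"
proof -
  have "0 < b" using assms by simp
  moreover have "c * a \<le> c * b" using assms by (intro mult_left_mono)
  ultimately show ?thesis using assms(3) by (simp add: divide_simps) (simp add: algebra_simps)
qed

lemma psd_scaleR: "psd A \<Longrightarrow> 0 \<le> r \<Longrightarrow> psd (r *\<^sub>R A)"
  unfolding psd_def hermitian_def by (metis complex_cnj_scaleR inner_scaleR_right
      scaleR_matrix_mult vector_scaleR_component zero_le_mult_iff)

lemma expval_scaleR: "expval (r *\<^sub>R A) \<rho> = r * expval A \<rho>"
  by (simp add: expval_def trace_def matrix_matrix_mult_def sum_distrib_left)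

lemma relative_cost_work_cost_le:
  assumes L: "free_states L" and \<rho>: "is_state \<rho>" and \<beta>: "0 < \<beta>"
    and H: "psd H" "work_cost \<beta> H \<rho> \<noteq> 0"
    and M: "\<And>\<sigma>. \<sigma> \<in> L \<Longrightarrow> work_cost \<beta> H \<sigma> \<le> M"
  shows "relative_cost (work_cost \<beta>) L \<rho> \<le> M / work_cost \<beta> H \<rho>"
proof (rule relative_cost_le)
  show "bdd_above (work_cost \<beta> H ` L)" if "psd H" for H
  proof (rule bdd_aboveI2)
    fix \<sigma> assume "\<sigma> \<in> L"
    then have \<sigma>: "is_state \<sigma>" using L by (auto simp: free_states_def)
    \<comment> \<open>Discarding the entropy leaves the energy, which the trace of \<open>H\<close>
      bounds uniformly.\<close>
    have "0 \<le> inverse \<beta> * entropy \<sigma>" using \<beta> state_entropy_nonneg[OF \<sigma>] by simp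
    then show "work_cost \<beta> H \<sigma> \<le> Re (trace H) - free_energy \<beta> H (thermal_state \<beta> H)"
      unfolding work_cost_def free_energy_def[of \<beta> H \<sigma>]
      using expval_le_trace[OF that \<sigma>] by linarith
  qed
qed (use assms work_cost_nonneg[OF \<beta> psd_hermitian] in \<open>auto simp: free_states_def\<close>)

lemma relative_cost_zero_temp_le:
  assumes L: "free_states L" and \<rho>: "is_state \<rho>"
    and H: "psd H" "work_cost_zero_temp H \<rho> \<noteq> 0"
    and M: "\<And>\<sigma>. \<sigma> \<in> L \<Longrightarrow> work_cost_zero_temp H \<sigma> \<le> M"
  shows "relative_cost work_cost_zero_temp L \<rho> \<le> M / work_cost_zero_temp H \<rho>"
proof (rule relative_cost_le)
  show "bdd_above (work_cost_zero_temp H ` L)" if "psd H" for H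
    using expval_le_trace[OF that] L
    by (intro bdd_aboveI2[of _ _ "Re (trace H) - Min (eigenvalues H)"])
      (auto simp: work_cost_zero_temp_def free_states_def)
qed (use assms Min_eigenvalues_le_expval[OF psd_hermitian]
  in \<open>auto simp: free_states_def work_cost_zero_temp_def\<close>)

theorem corollary1:
  fixes L :: "(complex^'n^'n) set" and \<rho> Y :: "complex^'n^'n" and \<beta> :: real
  assumes "free_states L"
    and "is_state \<rho>" and "\<rho> \<notin> L"
    and "optimal_witness L \<rho> Y"
    and "0 < \<beta>"
  defines "R \<equiv> real_of_ereal (robustness L \<rho>)"
  shows "(\<forall>l::real. 0 < l \<and> inverse \<beta> * entropy \<rho> / R \<le> l \<longrightarrow>
      relative_cost (work_cost \<beta>) L \<rho>
        \<le> (1 + inverse l * inverse \<beta> * entropy (thermal_state \<beta> (l *\<^sub>R Y)))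
          / (1 + R + inverse l * inverse \<beta> *
                (entropy (thermal_state \<beta> (l *\<^sub>R Y)) - entropy \<rho>)))
    \<and> relative_cost work_cost_zero_temp L \<rho> \<le> 1 / (1 + R)"
proof -
  have Y: "psd Y" and Y_le: "\<And>\<sigma>. \<sigma> \<in> L \<Longrightarrow> expval Y \<sigma> \<le> 1"
    and Y_opt: "robustness L \<rho> = ereal (expval Y \<rho> - 1)"
    using assms(4) unfolding optimal_witness_def by auto
  \<comment> \<open>The witness equation makes the robustness finite, so
    \<open>real_of_ereal\<close> returns its true value and not a default.\<close>
  have Y\<rho>: "expval Y \<rho> = 1 + R" by (simp add: R_def Y_opt)
  have R: "0 < R"
    using robustness_pos[OF assms(1-3)] unfolding R_def Y_opt by simp
  have states: "is_state \<sigma>" if "\<sigma> \<in> L" for \<sigma> using assms(1) that by (simp add: free_states_def)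
  obtain \<sigma>0 where \<sigma>0: "\<sigma>0 \<in> L" using assms(1) by (auto simp: free_states_def)
  show ?thesis
  proof (intro conjI allI impI)
    fix l :: real
    assume l: "0 < l \<and> inverse \<beta> * entropy \<rho> / R \<le> l"
    define H where "H = l *\<^sub>R Y"
    define t where "t = thermal_state \<beta> H"
    define a where "a = l + inverse \<beta> * entropy t"
    define b where "b = l * (1 + R) + inverse \<beta> * (entropy t - entropy \<rho>)"
    define c where "c = expval H t"
    have H: "psd H" unfolding H_def using Y l by (intro psd_scaleR) auto
    have c: "0 \<le> c" unfolding c_def t_def by (rule expval_thermal_state_nonneg[OF H])
    \<comment> \<open>The entropy of the thermal state cancels in \<open>b - a\<close>, which equals
      \<open>l * R - inverse \<beta> * entropy \<rho>\<close>; the threshold on \<open>l\<close> is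
      exactly its nonnegativity.\<close>
    have "inverse \<beta> * entropy \<rho> \<le> l * R" using l R by (simp add: pos_divide_le_eq)
    then have ab: "a \<le> b" by (simp add: a_def b_def algebra_simps)
    have W\<rho>: "work_cost \<beta> H \<rho> = b - c"
      by (simp add: work_cost_def free_energy_def t_def b_def c_def H_def expval_scaleR Y\<rho>
          algebra_simps)
    have W\<sigma>: "work_cost \<beta> H \<sigma> \<le> a - c" if "\<sigma> \<in> L" for \<sigma>
    proof -
      have "l * expval Y \<sigma> \<le> l * 1" using l Y_le[OF that] by (intro mult_left_mono) auto
      moreover have "0 \<le> inverse \<beta> * entropy \<sigma>"
        using \<open>0 < \<beta>\<close> state_entropy_nonneg[OF states[OF that]] by simp
      ultimately show ?thesis
        by (simp add: work_cost_def free_energy_def t_def a_def c_def H_def expval_scaleR)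
    qed
    text \<open>If \<open>\<rho>\<close> had zero work cost, so would every free state, and both would be the thermal
      state.\<close>
    have "work_cost \<beta> H \<rho> \<noteq> 0"
    proof
      assume 0: "work_cost \<beta> H \<rho> = 0"
      have "work_cost \<beta> H \<sigma>0 \<le> 0" using W\<sigma>[OF \<sigma>0] ab 0 W\<rho> by linarith
      then have "work_cost \<beta> H \<sigma>0 = 0"
        using work_cost_nonneg[OF \<open>0 < \<beta>\<close> psd_hermitian[OF H] states[OF \<sigma>0]] by linarith
      then have "\<sigma>0 = \<rho>"
        using 0 work_cost_zero_imp[OF \<open>0 < \<beta>\<close> psd_hermitian[OF H]] states[OF \<sigma>0] assms(2) by metis
      then show False using \<sigma>0 assms(3) by simp
    qed
    moreover from this have "0 < b - c"
      using work_cost_nonneg[OF \<open>0 < \<beta>\<close> psd_hermitian[OF H] assms(2)] W\<rho> by linarith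
    ultimately have "relative_cost (work_cost \<beta>) L \<rho> \<le> a / b"
      using relative_cost_work_cost_le[OF assms(1,2,5) H _ W\<sigma>] diff_divide_diff_le[OF c ab]
      unfolding W\<rho> by linarith
    \<comment> \<open>Dividing both by \<open>l\<close> gives the normalised form of the
      claim.\<close>
    also have "a / b = (inverse l * a) / (inverse l * b)" using l by simp
    also have "inverse l * a = 1 + inverse l * inverse \<beta> * entropy t"
      using l by (simp add: a_def distrib_left)
    also have "inverse l * b = 1 + R + inverse l * inverse \<beta> * (entropy t - entropy \<rho>)"
      using l by (simp add: b_def distrib_left)
    finally show "relative_cost (work_cost \<beta>) L \<rho>
        \<le> (1 + inverse l * inverse \<beta> * entropy (thermal_state \<beta> (l *\<^sub>R Y)))
          / (1 + R + inverse l * inverse \<beta> *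
                (entropy (thermal_state \<beta> (l *\<^sub>R Y)) - entropy \<rho>))"
      unfolding t_def H_def .
  next
    \<comment> \<open>At zero temperature a positive factor on \<open>H\<close> cancels in the
      ratio, so \<open>Y\<close> itself serves as Hamiltonian. Its ground energy \<open>m\<close>
      replaces \<open>c\<close>, with \<open>1\<close> and \<open>1 + R\<close> in place of
      \<open>a\<close> and \<open>b\<close>.\<close>
    define m where "m = Min (eigenvalues Y)"
    have m: "0 \<le> m" unfolding m_def by (rule Min_eigenvalues_nonneg[OF Y])
    \<comment> \<open>Any free state witnesses this; with \<open>R\<close> positive the denominator
      is then positive, so \<open>Y\<close> is admissible in the infimum.\<close>
    have "m \<le> 1"
      using Min_eigenvalues_le_expval[OF psd_hermitian[OF Y] states[OF \<sigma>0]] Y_le[OF \<sigma>0]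
      unfolding m_def by linarith
    then have pos: "0 < 1 + R - m" using R by simp
    have W\<rho>: "work_cost_zero_temp Y \<rho> = 1 + R - m"
      by (simp add: work_cost_zero_temp_def m_def Y\<rho>)
    have "relative_cost work_cost_zero_temp L \<rho> \<le> (1 - m) / (1 + R - m)"
      unfolding W\<rho>[symmetric]
      using relative_cost_zero_temp_le[OF assms(1,2) Y, of "1 - m"] pos Y_le W\<rho>
      by (simp add: work_cost_zero_temp_def m_def)
    also have "\<dots> \<le> 1 / (1 + R)"
      using m R pos by (intro diff_divide_diff_le) auto
    finally show "relative_cost work_cost_zero_temp L \<rho> \<le> 1 / (1 + R)" .
  qed
qed

end
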